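(* Let $u:\mathbb{R}_+\to\mathbb{R}^n$ be a piecewise continuous function that is of persistent excitation (PE) and uniformly bounded by $u_M$, i.e. $\|u(t)\|\le u_M$ for all $t\ge0$. Let $p_1,\dots,p_h>0$, let $p_m$ be the minimum exponent in the set $\{p_1,p_2,\dots,p_h\}$ and $p_M$ the maximum. If $p_M\le p_m+1$, then the origin $x=0$ of the system $$\dot{x}(t)=-\left(\sum_{i=1}^h\lceil u^T(t)x(t)\rfloor^{p_i}\right)u(t),\qquad x(t)\in\mathbb{R}^n,$$ is globally uniformly asymptotically stable.
   Context: Notation: for $w\in\mathbb{R}$ and an exponent $p>0$, $\lceil w\rfloor^p:=|w|^p\,\mathrm{sign}(w)$, with $\mathrm{sign}(0)=0$. $\|\cdot\|$ is the Euclidean norm. Solutions are absolutely continuous functions satisfying the differential equation for almost every $t\ge t_0$. Persistent excitation (PE): a piecewise continuous $u:\mathbb{R}_+\to\mathbb{R}^n$ is of PE if there exist $T>0$ and $\epsilon>0$ such that $\frac{1}{T}\int_{t}^{t+T}|u^T(s)w|\,ds\ge\epsilon$ for all $t\ge 0$ and all $w\in\mathbb{R}^n$ with $\|w\|=1$. "Uniformly" in asymptotic stability means uniformly in the initial time $t_0\ge 0$. *)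

theory Defs
  imports "HOL-Analysis.Analysis"
begin

definition signed_power :: "real \<Rightarrow> real \<Rightarrow> real" where
  "signed_power w p = \<bar>w\<bar> powr p * sgn w"

text \<open>
  Signals on the half-line are represented by total functions on the reals; only their values on
  \<open>{0..}\<close> are ever used. Piecewise continuity: finitely many discontinuities in every bounded
  interval, and finite one-sided limits everywhere.
\<close>

definition piecewise_continuous :: "(real \<Rightarrow> 'a::real_normed_vector) \<Rightarrow> bool" where
  "piecewise_continuous u \<longleftrightarrow>
     (\<forall>b. finite {t \<in> {0..b}. \<not> continuous (at t within {0..}) u}) \<and>
     (\<forall>t\<ge>0. \<exists>l. (u \<longlongrightarrow> l) (at_right t)) \<and>
     (\<forall>t>0. \<exists>l. (u \<longlongrightarrow> l) (at_left t))"

definition persistently_exciting :: "(real \<Rightarrow> 'a::euclidean_space) \<Rightarrow> bool" where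
  "persistently_exciting u \<longleftrightarrow>
     (\<exists>T>0. \<exists>\<epsilon>>0. \<forall>t\<ge>0. \<forall>w. norm w = 1 \<longrightarrow>
        (1 / T) * integral {t..t + T} (\<lambda>s. \<bar>u s \<bullet> w\<bar>) \<ge> \<epsilon>)"

text \<open>
  Absolute continuity on a compact interval. The members of \<open>d\<close> are finitely many non-overlapping
  compact subintervals, and \<open>Inf k\<close>, \<open>Sup k\<close> are the endpoints of \<open>k\<close>. The constant
  \<^const>\<open>absolutely_continuous\<close> of the library is the unrelated notion for measures.
\<close>

definition abs_continuous_on_Icc ::
    "real \<Rightarrow> real \<Rightarrow> (real \<Rightarrow> 'a::real_normed_vector) \<Rightarrow> bool" where
  "abs_continuous_on_Icc a b x \<longleftrightarrow>
     (\<forall>\<epsilon>>0. \<exists>\<delta>>0. \<forall>d. d division_of \<Union>d \<and> \<Union>d \<subseteq> {a..b} \<and>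
        (\<Sum>k\<in>d. Sup k - Inf k) < \<delta> \<longrightarrow> (\<Sum>k\<in>d. norm (x (Sup k) - x (Inf k))) < \<epsilon>)"

text \<open>
  Caratheodory solutions of \<open>x' = f t x\<close> started at time \<open>t0\<close>, on an interval \<open>J\<close> with left
  endpoint \<open>t0\<close> (for instance \<open>{t0..}\<close>, \<open>{t0..<\<tau>}\<close> or \<open>{t0..\<tau>}\<close>).
\<close>

definition ode_solution ::
    "(real \<Rightarrow> 'a::euclidean_space \<Rightarrow> 'a) \<Rightarrow> real \<Rightarrow> real set \<Rightarrow> (real \<Rightarrow> 'a) \<Rightarrow> bool" where
  "ode_solution f t0 J x \<longleftrightarrow>
     is_interval J \<and> t0 \<in> J \<and> J \<subseteq> {t0..} \<and>
     (\<forall>b\<in>J. abs_continuous_on_Icc t0 b x) \<and>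
     (AE t in lebesgue. t \<in> J \<longrightarrow> (x has_vector_derivative f t (x t)) (at t))"

text \<open>
  Uniform stability and attractivity are required of all solutions, including those given only on
  a bounded interval. If one considered solutions on \<open>{t0..}\<close> only, solutions with
  finite escape time would be ignored and \<open>x' = x\<^sup>3\<close> would qualify. The bound \<open>\<delta>\<close> is
  independent of \<open>t0\<close> and tends to infinity with \<open>\<epsilon>\<close> (uniform boundedness of solutions); the
  settling time \<open>\<tau>\<close> depends only on \<open>\<eta>\<close> and on the radius \<open>c\<close> of the ball of initial states.
\<close>

definition globally_uniformly_stable ::
    "(real \<Rightarrow> 'a::euclidean_space \<Rightarrow> 'a) \<Rightarrow> bool" where
  "globally_uniformly_stable f \<longleftrightarrow>
     (\<exists>\<delta> :: real \<Rightarrow> real. (\<forall>\<epsilon>>0. \<delta> \<epsilon> > 0) \<and> filterlim \<delta> at_top at_top \<and>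
        (\<forall>\<epsilon>>0. \<forall>t0\<ge>0. \<forall>J x. ode_solution f t0 J x \<and> norm (x t0) < \<delta> \<epsilon> \<longrightarrow>
           (\<forall>t\<in>J. norm (x t) < \<epsilon>)))"

definition globally_uniformly_attractive ::
    "(real \<Rightarrow> 'a::euclidean_space \<Rightarrow> 'a) \<Rightarrow> bool" where
  "globally_uniformly_attractive f \<longleftrightarrow>
     (\<forall>\<eta>>0. \<forall>c>0. \<exists>\<tau>>0. \<forall>t0\<ge>0. \<forall>J x. ode_solution f t0 J x \<and> norm (x t0) < c \<longrightarrow>
        (\<forall>t\<in>J. t \<ge> t0 + \<tau> \<longrightarrow> norm (x t) < \<eta>))"

definition origin_GUAS :: "(real \<Rightarrow> 'a::euclidean_space \<Rightarrow> 'a) \<Rightarrow> bool" where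
  "origin_GUAS f \<longleftrightarrow>
     (\<forall>t\<ge>0. f t 0 = 0) \<and> globally_uniformly_stable f \<and> globally_uniformly_attractive f"

end

theory Submission
  imports Defs
begin

text \<open>
  Write \<open>g y\<close> for the sum of the signed powers and \<open>W = y * g y\<close> at \<open>y = u \<bullet> x\<close>. Along solutions
  \<open>(norm x)\<^sup>2 / 2\<close> decreases at rate \<open>W \<ge> 0\<close>, which gives stability. For attractivity, both
  \<open>\<bar>y\<bar>\<close> and \<open>\<bar>g y\<bar>\<close> are at most \<open>\<alpha> + C * W\<close>, where \<open>\<alpha>\<close> is as small as desired. If \<open>norm x \<ge> \<eta>\<close>
  on a window of length \<open>T\<close> starting at \<open>t\<close>, persistent excitation bounds the integral of
  \<open>\<bar>u s \<bullet> x t\<bar> \<le> \<bar>u s \<bullet> x s\<bar> + u_M * norm (x s - x t)\<close> from below by \<open>\<epsilon> * T * \<eta>\<close>, whereas both terms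
  on the right are controlled by \<open>\<alpha>\<close> and the integral of \<open>W\<close> over the window. So every such
  window consumes a fixed amount of energy, and only boundedly many of them can occur.
\<close>

section \<open>Absolute continuity and the fundamental theorem of calculus\<close>

lemma abs_continuous_on_Icc_subset:
  assumes "abs_continuous_on_Icc a b x" "a \<le> a'" "b' \<le> b"
  shows "abs_continuous_on_Icc a' b' x"
proof -
  have "{a'..b'} \<subseteq> {a..b}"
    using assms by auto
  then show ?thesis
    using assms(1) unfolding abs_continuous_on_Icc_def by (meson subset_trans)
qed

text \<open>A division with a single short interval already bounds the increment of \<open>x\<close>
  across that interval.\<close>

lemma abs_continuous_on_Icc_imp_continuous_on:
  assumes "abs_continuous_on_Icc a b x"
  shows "continuous_on {a..b} x"
  unfolding continuous_on_iff
proof (intro ballI allI impI)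
  fix s e :: real
  assume s: "s \<in> {a..b}" and "e > 0"
  then obtain \<delta> where \<delta>: "\<delta> > 0" "\<And>d. d division_of \<Union>d \<Longrightarrow> \<Union>d \<subseteq> {a..b} \<Longrightarrow>
      (\<Sum>k\<in>d. Sup k - Inf k) < \<delta> \<Longrightarrow> (\<Sum>k\<in>d. norm (x (Sup k) - x (Inf k))) < e"
    using assms unfolding abs_continuous_on_Icc_def by meson
  have *: "norm (x q - x r) < e" if "r \<in> {a..b}" "q \<in> {a..b}" "r \<le> q" "q - r < \<delta>" for q r
  proof -
    have "{{r..q}} division_of \<Union>{{r..q}}"
      using that division_of_self[of r q] by simp
    moreover have "\<Union>{{r..q}} \<subseteq> {a..b}"
      using that by auto
    ultimately show ?thesis
      using \<delta>(2)[of "{{r..q}}"] that by simp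
  qed
  show "\<exists>d>0. \<forall>t\<in>{a..b}. dist t s < d \<longrightarrow> dist (x t) (x s) < e"
  proof (intro exI[of _ \<delta>] conjI ballI impI)
    fix t assume "t \<in> {a..b}" "dist t s < \<delta>"
    then show "dist (x t) (x s) < e"
      using *[of s t] *[of t s] s
      by (cases "s \<le> t") (auto simp: dist_norm norm_minus_commute)
  qed (fact \<delta>(1))
qed

lemma abs_continuous_on_Icc_lipschitz_compose:
  assumes x: "abs_continuous_on_Icc a b x" and \<phi>: "L-lipschitz_on (x ` {a..b}) \<phi>"
  shows "abs_continuous_on_Icc a b (\<lambda>t. \<phi> (x t))"
  unfolding abs_continuous_on_Icc_def
proof (intro allI impI)
  fix e :: real assume "e > 0"
  have L: "L \<ge> 0"
    using \<phi> by (rule lipschitz_on_nonneg)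
  \<comment> \<open>Dividing by \<open>L + 1\<close> instead of \<open>L\<close> covers the case
    \<open>L = 0\<close>.\<close>
  have "e / (L + 1) > 0"
    using \<open>e > 0\<close> L by simp
  then obtain \<delta> where \<delta>: "\<delta> > 0" "\<And>d. d division_of \<Union>d \<Longrightarrow> \<Union>d \<subseteq> {a..b} \<Longrightarrow>
      (\<Sum>k\<in>d. Sup k - Inf k) < \<delta> \<Longrightarrow> (\<Sum>k\<in>d. norm (x (Sup k) - x (Inf k))) < e / (L + 1)"
    using x unfolding abs_continuous_on_Icc_def by meson
  show "\<exists>\<delta>>0. \<forall>d. d division_of \<Union>d \<and> \<Union>d \<subseteq> {a..b} \<and> (\<Sum>k\<in>d. Sup k - Inf k) < \<delta> \<longrightarrow>
      (\<Sum>k\<in>d. norm (\<phi> (x (Sup k)) - \<phi> (x (Inf k)))) < e"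
  proof (intro exI[of _ \<delta>] conjI allI impI; (elim conjE)?)
    fix d assume d: "d division_of \<Union>d" "\<Union>d \<subseteq> {a..b}" "(\<Sum>k\<in>d. Sup k - Inf k) < \<delta>"
    have "(\<Sum>k\<in>d. norm (\<phi> (x (Sup k)) - \<phi> (x (Inf k)))) \<le> (\<Sum>k\<in>d. L * norm (x (Sup k) - x (Inf k)))"
    proof (rule sum_mono)
      fix k assume "k \<in> d"
      then obtain q r where k: "k = {q..r}" "k \<noteq> {}"
        using division_ofD(3,4)[OF d(1)] by (metis box_real(2))
      have "k \<subseteq> {a..b}"
        using \<open>k \<in> d\<close> d(2) by blast
      then have "Sup k \<in> {a..b}" "Inf k \<in> {a..b}"
        using k by auto
      then show "norm (\<phi> (x (Sup k)) - \<phi> (x (Inf k))) \<le> L * norm (x (Sup k) - x (Inf k))"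
        using lipschitz_onD[OF \<phi>] by (simp add: dist_norm)
    qed
    also have "\<dots> \<le> (L + 1) * (\<Sum>k\<in>d. norm (x (Sup k) - x (Inf k)))"
      by (simp add: sum_distrib_left[symmetric] mult_right_mono sum_nonneg)
    also have "\<dots> < (L + 1) * (e / (L + 1))"
      using \<delta>(2)[OF d] L by (intro mult_strict_left_mono) auto
    also have "\<dots> = e"
      using L by simp
    finally show "(\<Sum>k\<in>d. norm (\<phi> (x (Sup k)) - \<phi> (x (Inf k)))) < e" .
  qed (fact \<delta>(1))
qed

text \<open>The image of the compact interval lies in a ball of some radius \<open>M\<close>, on
  which the squared norm is Lipschitz with constant \<open>2 * M\<close>.\<close>

lemma abs_continuous_on_Icc_norm_power2:
  assumes "abs_continuous_on_Icc a b x"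
  shows "abs_continuous_on_Icc a b (\<lambda>t. (norm (x t))\<^sup>2)"
proof -
  have "bounded (x ` {a..b})"
    using abs_continuous_on_Icc_imp_continuous_on[OF assms]
    by (intro compact_imp_bounded compact_continuous_image) auto
  then obtain M where M: "M > 0" "\<And>y. y \<in> x ` {a..b} \<Longrightarrow> norm y \<le> M"
    by (meson bounded_pos)
  have "(2 * M)-lipschitz_on (x ` {a..b}) (\<lambda>y. (norm y)\<^sup>2)"
  proof (rule lipschitz_onI)
    fix y z assume "y \<in> x ` {a..b}" "z \<in> x ` {a..b}"
    then have "norm y + norm z \<le> 2 * M"
      using M(2)[of y] M(2)[of z] by simp
    moreover have "\<bar>norm y - norm z\<bar> \<le> dist y z"
      by (simp add: dist_norm norm_triangle_ineq3)
    ultimately have "(norm y + norm z) * \<bar>norm y - norm z\<bar> \<le> (2 * M) * dist y z"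
      using M(1) by (intro mult_mono) auto
    moreover have "\<bar>(norm y)\<^sup>2 - (norm z)\<^sup>2\<bar> = (norm y + norm z) * \<bar>norm y - norm z\<bar>"
      by (simp add: square_diff_square_factored power2_eq_square abs_mult)
    ultimately show "dist ((norm y)\<^sup>2) ((norm z)\<^sup>2) \<le> 2 * M * dist y z"
      by (simp add: dist_real_def)
  qed (use M in simp)
  then show ?thesis
    by (rule abs_continuous_on_Icc_lipschitz_compose[OF assms])
qed

section \<open>The fundamental theorem of calculus for absolutely continuous functions\<close>

text \<open>Distinct members of a division meet in a convex set with empty interior, hence in a
  negligible set, so their contents add up to the measure of the union.\<close>

lemma sum_content_division_le_measure:
  fixes d :: "'a::euclidean_space set set"
  assumes d: "d division_of \<Union>d" and U: "\<Union>d \<subseteq> U" "U \<in> lmeasurable"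
  shows "(\<Sum>k\<in>d. measure lborel k) \<le> measure lebesgue U"
proof -
  have cb: "\<exists>q r. k = cbox q r" if "k \<in> d" for k
    using division_ofD(4)[OF d that] .
  have lm: "k \<in> lmeasurable" if "k \<in> d" for k
    using cb[OF that] by auto
  have "negligible (k \<inter> l)" if "k \<in> d" "l \<in> d" "k \<noteq> l" for k l
  proof (rule negligible_convex_interior[THEN iffD2])
    show "convex (k \<inter> l)"
      using cb that by (metis convex_Int convex_box(1))
    show "interior (k \<inter> l) = {}"
      using division_ofD(5)[OF d that] by (simp add: interior_Int)
  qed
  then have "measure lebesgue (\<Union>d) = (\<Sum>k\<in>d. measure lebesgue k)"
    using division_ofD(1)[OF d] lm
    by (intro measure_negligible_finite_Union) (auto simp: pairwise_def)
  also have "\<dots> = (\<Sum>k\<in>d. measure lborel k)"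
    using division_ofD(4)[OF d] by (intro sum.cong refl) (force simp: measure_completion)
  finally have "(\<Sum>k\<in>d. measure lborel k) = measure lebesgue (\<Union>d)" by simp
  also have "\<dots> \<le> measure lebesgue U"
    using U lm division_ofD(1)[OF d]
    by (intro measure_mono_fmeasurable fmeasurableD fmeasurable.finite_Union) auto
  finally show ?thesis .
qed

text \<open>
  Tags outside the exceptional set are treated as in the classical proof. Those inside it are
  confined to an open set of small measure, on which absolute continuity applies.
\<close>

lemma fundamental_theorem_of_calculus_abs_continuous:
  fixes F :: "real \<Rightarrow> 'a::euclidean_space"
  assumes "a \<le> b" and AC: "abs_continuous_on_Icc a b F" and N: "negligible N"
    and der: "\<And>t. t \<in> {a..b} - N \<Longrightarrow> (F has_vector_derivative f t) (at t within {a..b})"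
  shows "(f has_integral (F b - F a)) {a..b}"
proof (rule has_integral_spike[OF N])
  \<comment> \<open>With the integrand set to zero on \<open>N\<close>, a tag in \<open>N\<close>
    contributes to the error only the increment of \<open>F\<close> over its interval.\<close>
  define f0 where "f0 t = (if t \<in> N then 0 else f t)" for t
  show "f t = f0 t" if "t \<in> {a..b} - N" for t
    using that by (simp add: f0_def)
  show "(f0 has_integral (F b - F a)) {a..b}"
    unfolding has_integral_real
  proof (intro allI impI)
    fix e :: real assume "e > 0"
    \<comment> \<open>The factor 2 reserves the other half of \<open>e\<close> for the tags in
      \<open>N\<close>; the summand 1 keeps the denominator positive when
      \<open>a = b\<close>.\<close>
    define e' where "e' = e / (2 * (b - a + 1))"
    have e': "e' > 0" "e' * (b - a) < e / 2"
      using \<open>e > 0\<close> \<open>a \<le> b\<close> by (auto simp: e'_def field_simps)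
    obtain \<delta> where \<delta>: "\<delta> > 0" "\<And>d. d division_of \<Union>d \<Longrightarrow> \<Union>d \<subseteq> {a..b} \<Longrightarrow>
        (\<Sum>k\<in>d. Sup k - Inf k) < \<delta> \<Longrightarrow> (\<Sum>k\<in>d. norm (F (Sup k) - F (Inf k))) < e / 2"
      using AC \<open>e > 0\<close> unfolding abs_continuous_on_Icc_def by (meson half_gt_zero)
    have N0: "N \<in> null_sets lebesgue"
      using N by (simp add: negligible_iff_null_sets)
    \<comment> \<open>Here \<open>\<delta>\<close> comes from absolute continuity: the increments of
      \<open>F\<close> over non-overlapping intervals inside both \<open>U\<close> and
      \<open>{a..b}\<close> will sum to less than \<open>e / 2\<close>.\<close>
    then obtain U where U: "open U" "N \<subseteq> U" "U - N \<in> lmeasurable"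
        "emeasure lebesgue (U - N) < ennreal \<delta>"
      using sets_lebesgue_outer_open[OF null_setsD2[OF N0] \<delta>(1)] by blast
    have NU: "U = (U - N) \<union> N"
      using U(2) by blast
    have Nm: "N \<in> lmeasurable"
      using N by (simp add: negligible_imp_measurable)
    have Um: "U \<in> lmeasurable"
      by (subst NU) (intro fmeasurable.Un U(3) Nm)
    have "measure lebesgue U \<le> measure lebesgue (U - N) + measure lebesgue N"
      by (subst NU, rule measure_Un_le) (use U(3) Nm in auto)
    also have "measure lebesgue N = 0"
      using N0 by (simp add: measure_eq_0_null_sets)
    also have "measure lebesgue (U - N) < \<delta>"
      using U(4) \<delta>(1) emeasure_eq_measure2[OF U(3)] by (simp add: ennreal_less_iff)
    finally have U\<delta>: "measure lebesgue U < \<delta>" by simp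
    have "\<forall>t. \<exists>d>0. t \<in> {a..b} - N \<longrightarrow> (\<forall>s\<in>{a..b}. norm (s - t) < d \<longrightarrow>
        norm (F s - F t - (s - t) *\<^sub>R f t) \<le> e' * norm (s - t))"
      using der[unfolded has_vector_derivative_def has_derivative_within_alt] e'(1)
      by (metis zero_less_one)
    then obtain d where d: "\<And>t. d t > 0"
      "\<And>t s. t \<in> {a..b} - N \<Longrightarrow> s \<in> {a..b} \<Longrightarrow> norm (s - t) < d t \<Longrightarrow>
        norm (F s - F t - (s - t) *\<^sub>R f t) \<le> e' * norm (s - t)"
      by metis
    define \<gamma> where "\<gamma> t = (if t \<in> N then U else ball t (d t))" for t
    show "\<exists>\<gamma>. gauge \<gamma> \<and> (\<forall>p. p tagged_division_of {a..b} \<and> \<gamma> fine p \<longrightarrow>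
        norm ((\<Sum>(t, k)\<in>p. measure lborel k *\<^sub>R f0 t) - (F b - F a)) < e)"
    proof (intro exI[of _ \<gamma>] conjI allI impI; (elim conjE)?)
      show "gauge \<gamma>"
        using U(1,2) d(1) by (auto simp: gauge_def \<gamma>_def)
    next
      fix p assume p: "p tagged_division_of {a..b}" and fine: "\<gamma> fine p"
      define q where "q = {z \<in> p. fst z \<in> N}"
      have fin: "finite p" and qp: "q \<subseteq> p"
        using p by (auto simp: q_def)
      have pk: "\<exists>r v. k = {r..v} \<and> r \<le> v \<and> t \<in> k \<and> k \<subseteq> {a..b}" if "(t, k) \<in> p" for t k
        using tagged_division_ofD(2-4)[OF p that] by auto
      have "p tagged_partial_division_of {a..b}"
        using p by (simp add: tagged_division_of_def)
      then have q: "q tagged_partial_division_of {a..b}"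
        using qp by (rule tagged_partial_division_subset)
      have qk: "\<exists>r v. k = {r..v} \<and> r \<le> v \<and> k \<subseteq> {a..b}" if k: "k \<in> snd ` q" for k
      proof -
        obtain t where "(t, k) \<in> q"
          using k by force
        then have "(t, k) \<in> p"
          using qp by blast
        from pk[OF this] show ?thesis by blast
      qed
      note q' = partial_division_of_tagged_division[OF q]
      have "(\<Sum>k\<in>snd ` q. Sup k - Inf k) = (\<Sum>k\<in>snd ` q. measure lborel k)"
      proof (rule sum.cong)
        fix k assume "k \<in> snd ` q"
        then obtain r v where "k = {r..v}" "r \<le> v"
          using qk by blast
        then show "Sup k - Inf k = measure lborel k" by simp
      qed simp
      also have "\<dots> \<le> measure lebesgue U"
      proof (rule sum_content_division_le_measure[OF q' _ Um])
        show "\<Union>(snd ` q) \<subseteq> U"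
        proof (rule Union_least)
          fix k assume "k \<in> snd ` q"
          then obtain t where "(t, k) \<in> p" "t \<in> N"
            by (auto simp: q_def)
          then show "k \<subseteq> U"
            using fineD[OF fine, of t k] by (simp add: \<gamma>_def)
        qed
      qed
      finally have "(\<Sum>k\<in>snd ` q. Sup k - Inf k) < \<delta>"
        using U\<delta> by simp
      moreover have "\<Union>(snd ` q) \<subseteq> {a..b}"
        using qk by (intro Union_least) blast
      ultimately have "(\<Sum>k\<in>snd ` q. norm (F (Sup k) - F (Inf k))) < e / 2"
        using \<delta>(2)[OF q'] by simp
      moreover have "(\<Sum>(t, k)\<in>q. norm (F (Sup k) - F (Inf k)))
          = (\<Sum>k\<in>snd ` q. norm (F (Sup k) - F (Inf k)))"
      proof -
        \<comment> \<open>Different tags in \<open>q\<close> may share an interval only if it is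
          degenerate. \<open>D\<close> vanishes there, so summing over tagged pairs or over
          intervals gives the same value. The empty set is set apart because its \<open>Sup\<close>
          and \<open>Inf\<close> carry no information.\<close>
        define D where "D k = (if k = {} then 0 else norm (F (Sup k) - F (Inf k)))" for k
        have D: "D k = norm (F (Sup k) - F (Inf k))" if "k \<in> snd ` q" for k
          using qk[OF that] by (auto simp: D_def)
        have "(\<Sum>(t, k)\<in>q. D k) = (\<Sum>k\<in>snd ` q. D k)"
        proof (rule sum.over_tagged_division_lemma[OF tagged_partial_division_of_Union_self[OF q]])
          fix r v :: real assume "box r v = {}"
          then show "D (cbox r v) = 0"
            by (cases "v = r") (auto simp: D_def)
        qed
        moreover have "(\<Sum>(t, k)\<in>q. D k) = (\<Sum>(t, k)\<in>q. norm (F (Sup k) - F (Inf k)))"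
          using D by (intro sum.cong) force+
        ultimately show ?thesis
          using D by simp
      qed
      ultimately have inN: "(\<Sum>(t, k)\<in>q. norm (F (Sup k) - F (Inf k))) < e / 2"
        by simp
      have len: "b - a = (\<Sum>(t, k)\<in>p. Sup k - Inf k)"
        and inc: "F b - F a = (\<Sum>(t, k)\<in>p. F (Sup k) - F (Inf k))"
        using additive_tagged_division_1[where f = "\<lambda>x. x"] additive_tagged_division_1[where f = F]
          \<open>a \<le> b\<close> p by auto
      have outN: "norm (measure lborel k *\<^sub>R f0 t - (F (Sup k) - F (Inf k))) \<le> e' * (Sup k - Inf k)"
        if tk: "(t, k) \<in> p - q" for t k
      proof -
        obtain r v where k: "k = {r..v}" "r \<le> v" "t \<in> k" "k \<subseteq> {a..b}"
          using pk tk by blast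
        have t: "t \<in> {a..b} - N"
          using tk k by (auto simp: q_def)
        have "k \<subseteq> ball t (d t)"
          using fineD[OF fine, of t k] tk t by (simp add: \<gamma>_def)
        then have rv: "norm (r - t) < d t" "norm (v - t) < d t"
          using k(1,2) by (auto simp: subset_iff dist_real_def abs_minus_commute)
        \<comment> \<open>Straddling: the tag lies between the endpoints, so the two linearization
          errors, at \<open>r\<close> and at \<open>v\<close>, add up to at most \<open>e'\<close>
          times the full length.\<close>
        have "(v - r) *\<^sub>R f t - (F v - F r)
            = (F r - F t - (r - t) *\<^sub>R f t) - (F v - F t - (v - t) *\<^sub>R f t)"
          by (simp add: algebra_simps)
        then have "norm ((v - r) *\<^sub>R f t - (F v - F r))
            \<le> norm (F r - F t - (r - t) *\<^sub>R f t) + norm (F v - F t - (v - t) *\<^sub>R f t)"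
          by (metis norm_triangle_ineq4)
        also have "\<dots> \<le> e' * norm (r - t) + e' * norm (v - t)"
          using k by (intro add_mono d(2) t rv) auto
        also have "\<dots> = e' * (v - r)"
          using k by (auto simp: algebra_simps)
        finally show ?thesis
          using k t by (simp add: f0_def)
      qed
      have "(\<Sum>(t, k)\<in>p. measure lborel k *\<^sub>R f0 t) - (F b - F a)
          = (\<Sum>(t, k)\<in>p. measure lborel k *\<^sub>R f0 t - (F (Sup k) - F (Inf k)))"
        by (simp add: inc split_def sum_subtractf)
      also have "norm \<dots> \<le> (\<Sum>(t, k)\<in>p. norm (measure lborel k *\<^sub>R f0 t - (F (Sup k) - F (Inf k))))"
        by (rule order_trans[OF norm_sum]) (simp add: split_def)
      also have "\<dots> = (\<Sum>(t, k)\<in>p - q. norm (measure lborel k *\<^sub>R f0 t - (F (Sup k) - F (Inf k))))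
          + (\<Sum>(t, k)\<in>q. norm (measure lborel k *\<^sub>R f0 t - (F (Sup k) - F (Inf k))))"
        by (rule sum.subset_diff[OF qp fin])
      also have "(\<Sum>(t, k)\<in>q. norm (measure lborel k *\<^sub>R f0 t - (F (Sup k) - F (Inf k))))
          = (\<Sum>(t, k)\<in>q. norm (F (Sup k) - F (Inf k)))"
        by (intro sum.cong) (auto simp: q_def f0_def norm_minus_commute)
      also have "(\<Sum>(t, k)\<in>p - q. norm (measure lborel k *\<^sub>R f0 t - (F (Sup k) - F (Inf k))))
          \<le> (\<Sum>(t, k)\<in>p - q. e' * (Sup k - Inf k))"
        using outN by (intro sum_mono) auto
      also have "\<dots> \<le> (\<Sum>(t, k)\<in>p. e' * (Sup k - Inf k))"
      proof (rule sum_mono2[OF fin])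
        fix z assume "z \<in> p - (p - q)"
        then obtain t k r v where "z = (t, k)" "k = {r..v}" "r \<le> v"
          using pk by (metis DiffD1 surj_pair)
        then show "0 \<le> (case z of (t, k) \<Rightarrow> e' * (Sup k - Inf k))"
          using e'(1) by simp
      qed auto
      also have "\<dots> = e' * (b - a)"
        by (simp add: len sum_distrib_left split_def)
      finally show "norm ((\<Sum>(t, k)\<in>p. measure lborel k *\<^sub>R f0 t) - (F b - F a)) < e"
        using inN e'(2) by simp
    qed
  qed
qed

section \<open>Integral identities along solutions\<close>

context
  fixes f :: "real \<Rightarrow> 'a::euclidean_space \<Rightarrow> 'a" and t0 a b :: real and J :: "real set"
    and x :: "real \<Rightarrow> 'a"
  assumes sol: "ode_solution f t0 J x" and ab: "t0 \<le> a" "a \<le> b" "b \<in> J"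
begin

lemma ode_solution_abs_continuous: "abs_continuous_on_Icc a b x"
  using sol ab unfolding ode_solution_def
  by (meson abs_continuous_on_Icc_subset order_refl)

lemma ode_solution_derivative:
  obtains N where "negligible N"
    "\<And>t. t \<in> {a..b} - N \<Longrightarrow> (x has_vector_derivative f t (x t)) (at t within {a..b})"
proof -
  have "AE t in lebesgue. t \<in> J \<longrightarrow> (x has_vector_derivative f t (x t)) (at t)"
    using sol by (simp add: ode_solution_def)
  then obtain N where N: "N \<in> null_sets lebesgue"
      "\<And>t. t \<in> space lebesgue - N \<Longrightarrow> t \<in> J \<longrightarrow> (x has_vector_derivative f t (x t)) (at t)"
    by (rule AE_E3) blast
  have "t0 \<in> J" "is_interval J"
    using sol by (simp_all add: ode_solution_def)
  then have "{a..b} \<subseteq> J"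
    using ab unfolding is_interval_1 by (meson atLeastAtMost_iff order_trans subsetI)
  then have "(x has_vector_derivative f t (x t)) (at t within {a..b})" if "t \<in> {a..b} - N" for t
    using N(2)[of t] that has_vector_derivative_at_within by auto
  moreover have "negligible N"
    using N(1) by (simp add: negligible_iff_null_sets)
  ultimately show ?thesis
    using that by blast
qed

lemma ode_solution_has_integral:
  "((\<lambda>t. f t (x t)) has_integral (x b - x a)) {a..b}"
proof -
  obtain N where N: "negligible N"
    "\<And>t. t \<in> {a..b} - N \<Longrightarrow> (x has_vector_derivative f t (x t)) (at t within {a..b})"
    by (rule ode_solution_derivative) blast
  show ?thesis
    using ab(2) ode_solution_abs_continuous N
    by (rule fundamental_theorem_of_calculus_abs_continuous)
qed

text \<open>The squared norm is again absolutely continuous, with derivative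
  \<open>2 * (x t \<bullet> f t (x t))\<close> off the null set, so the same fundamental theorem
  applies.\<close>

lemma ode_solution_has_integral_energy:
  "((\<lambda>t. x t \<bullet> f t (x t)) has_integral ((norm (x b))\<^sup>2 - (norm (x a))\<^sup>2) / 2) {a..b}"
proof -
  obtain N where N: "negligible N"
    "\<And>t. t \<in> {a..b} - N \<Longrightarrow> (x has_vector_derivative f t (x t)) (at t within {a..b})"
    by (rule ode_solution_derivative) blast
  have "((\<lambda>t. (norm (x t))\<^sup>2) has_vector_derivative 2 * (x t \<bullet> f t (x t))) (at t within {a..b})"
    if "t \<in> {a..b} - N" for t
    using bounded_bilinear.has_vector_derivative[OF bounded_bilinear_inner N(2)[OF that] N(2)[OF that]]
    by (simp add: power2_norm_eq_inner inner_commute)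
  then have "((\<lambda>t. 2 * (x t \<bullet> f t (x t))) has_integral ((norm (x b))\<^sup>2 - (norm (x a))\<^sup>2)) {a..b}"
    by (rule fundamental_theorem_of_calculus_abs_continuous[OF ab(2)
          abs_continuous_on_Icc_norm_power2[OF ode_solution_abs_continuous] N(1)])
  then show ?thesis
    by (auto dest: has_integral_divide[where c = 2])
qed

end

section \<open>Gradient-type flows under persistent excitation\<close>

text \<open>\<open>g\<close> abstracts the sum of signed powers. The sign condition makes the energy
  decrease, continuity at \<open>0\<close> governs small \<open>y\<close>, and \<open>g_away\<close>
  governs all other \<open>y\<close>.\<close>

context
  fixes u :: "real \<Rightarrow> 'a::euclidean_space" and u_M :: real and g :: "real \<Rightarrow> real"
  assumes u: "persistently_exciting u" "\<And>t. t \<ge> 0 \<Longrightarrow> norm (u t) \<le> u_M"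
    and g_0: "g 0 = 0" and g_cont: "isCont g 0"
    and g_sgn: "\<And>y. 0 \<le> y * g y"
    and g_away: "\<And>\<delta>. \<delta> > 0 \<Longrightarrow> \<exists>m>0. \<forall>y. \<delta> \<le> \<bar>y\<bar> \<longrightarrow> m \<le> \<bar>g y\<bar>"
begin

abbreviation (input) flow :: "real \<Rightarrow> 'a \<Rightarrow> 'a" where
  "flow \<equiv> \<lambda>t x. - (g (u t \<bullet> x) *\<^sub>R u t)"

section \<open>Energy balance and monotonicity of the norm\<close>

lemma u_M_nonneg: "0 \<le> u_M"
  using u(2)[of 0] norm_ge_zero[of "u 0"] by linarith

lemma flow_energy:
  assumes "ode_solution flow t0 J x" "t0 \<le> a" "a \<le> b" "b \<in> J"
  shows "((\<lambda>t. (u t \<bullet> x t) * g (u t \<bullet> x t)) has_integral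
      ((norm (x a))\<^sup>2 - (norm (x b))\<^sup>2) / 2) {a..b}"
  using has_integral_neg[OF ode_solution_has_integral_energy[OF assms]]
  by (simp add: inner_commute mult.commute minus_divide_left)

lemma flow_norm_antimono:
  assumes "ode_solution flow t0 J x" "t0 \<le> a" "a \<le> b" "b \<in> J"
  shows "norm (x b) \<le> norm (x a)"
proof -
  have "0 \<le> ((norm (x a))\<^sup>2 - (norm (x b))\<^sup>2) / 2"
    using flow_energy[OF assms] g_sgn by (rule has_integral_nonneg)
  then show ?thesis
    by (simp add: power2_le_iff_abs_le)
qed

section \<open>Energy loss over one excitation window\<close>

text \<open>The dissipation \<open>y * g y\<close> equals
  \<open>\<bar>y\<bar> * \<bar>g y\<bar>\<close>. Near zero both factors are below
  \<open>\<alpha>\<close>; for \<open>\<bar>y\<bar> \<ge> \<delta>\<close> each factor is bounded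
  below, by \<open>\<delta>\<close> and \<open>m\<close>, so dividing by it bounds the other one by
  a multiple of the dissipation.\<close>

lemma abs_le_dissipation:
  assumes "\<alpha> > 0"
  obtains C where "C > 0" "\<And>y. \<bar>y\<bar> \<le> \<alpha> + C * (y * g y)" "\<And>y. \<bar>g y\<bar> \<le> \<alpha> + C * (y * g y)"
proof -
  obtain r where r: "r > 0" "\<And>y. \<bar>y\<bar> < r \<Longrightarrow> \<bar>g y\<bar> < \<alpha>"
    using g_cont assms unfolding continuous_at_eps_delta by (auto simp: g_0 dist_real_def)
  define \<delta> where "\<delta> = min r \<alpha>"
  have "\<delta> > 0"
    using r assms by (simp add: \<delta>_def)
  then obtain m where m: "m > 0" "\<And>y. \<delta> \<le> \<bar>y\<bar> \<Longrightarrow> m \<le> \<bar>g y\<bar>"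
    using g_away by blast
  define C where "C = 1 / m + 1 / \<delta>"
  have W: "y * g y = \<bar>y\<bar> * \<bar>g y\<bar>" for y
    using g_sgn[of y] by (simp add: abs_mult[symmetric])
  have C: "C > 0" "1 / m \<le> C" "1 / \<delta> \<le> C"
    using m(1) \<open>\<delta> > 0\<close> by (auto simp: C_def add_pos_pos)
  have *: "\<bar>y\<bar> \<le> \<alpha> + C * (y * g y) \<and> \<bar>g y\<bar> \<le> \<alpha> + C * (y * g y)" for y
  proof (cases "\<bar>y\<bar> < \<delta>")
    case True
    have "0 \<le> C * (y * g y)"
      using C g_sgn by simp
    then show ?thesis
      using True r(2)[of y] by (auto simp: \<delta>_def)
  next
    case False
    then have "\<delta> \<le> \<bar>y\<bar>" by simp
    have "\<bar>y\<bar> = (1 / m) * (\<bar>y\<bar> * m)"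
      using m(1) by simp
    also have "\<dots> \<le> C * (\<bar>y\<bar> * \<bar>g y\<bar>)"
      using C m \<open>\<delta> \<le> \<bar>y\<bar>\<close> by (intro mult_mono) auto
    finally have "\<bar>y\<bar> \<le> C * (y * g y)"
      by (simp add: W)
    moreover have "\<bar>g y\<bar> = (1 / \<delta>) * (\<delta> * \<bar>g y\<bar>)"
      using \<open>\<delta> > 0\<close> by simp
    then have "\<bar>g y\<bar> \<le> C * (y * g y)"
      using C \<open>\<delta> \<le> \<bar>y\<bar>\<close> \<open>\<delta> > 0\<close> unfolding W by (metis abs_ge_zero less_imp_le mult_mono mult_nonneg_nonneg mult_right_mono)
    ultimately show ?thesis
      using assms by simp
  qed
  show ?thesis
    using that C(1) * by blast
qed

text \<open>The speed is at most \<open>u_M * \<bar>g y\<bar>\<close> at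
  \<open>y = u t \<bullet> x t\<close>. Integrating the bound on \<open>\<bar>g y\<bar>\<close>
  turns the dissipation term into half the drop of the squared norm, by
  \<open>flow_energy\<close>.\<close>

lemma flow_increment_le:
  assumes sol: "ode_solution flow t0 J x" "0 \<le> t0" "t0 \<le> a" "a \<le> b" "b \<in> J"
    and C: "\<And>y. \<bar>g y\<bar> \<le> \<alpha> + C * (y * g y)"
  shows "norm (x b - x a) \<le> u_M * (\<alpha> * (b - a) + C * (((norm (x a))\<^sup>2 - (norm (x b))\<^sup>2) / 2))"
proof -
  note I = ode_solution_has_integral[OF sol(1,3-5)]
  have "((\<lambda>t. \<alpha> + C * ((u t \<bullet> x t) * g (u t \<bullet> x t))) has_integral
      (b - a) * \<alpha> + C * (((norm (x a))\<^sup>2 - (norm (x b))\<^sup>2) / 2)) {a..b}"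
    using has_integral_const_real[of \<alpha> a b] sol(4)
    by (intro has_integral_add has_integral_mult_right flow_energy[OF sol(1,3-5)]) auto
  then have D: "((\<lambda>t. u_M * (\<alpha> + C * ((u t \<bullet> x t) * g (u t \<bullet> x t)))) has_integral
      u_M * (\<alpha> * (b - a) + C * (((norm (x a))\<^sup>2 - (norm (x b))\<^sup>2) / 2))) {a..b}"
    by (subst mult.commute[of \<alpha>]) (rule has_integral_mult_right)
  have "norm (flow t (x t)) \<le> u_M * (\<alpha> + C * ((u t \<bullet> x t) * g (u t \<bullet> x t)))" if "t \<in> {a..b}" for t
  proof -
    have "\<bar>g (u t \<bullet> x t)\<bar> * norm (u t) \<le> (\<alpha> + C * ((u t \<bullet> x t) * g (u t \<bullet> x t))) * u_M"
      using that sol C[of "u t \<bullet> x t"] u(2)[of t]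
      by (intro mult_mono) (auto intro: order_trans[OF abs_ge_zero])
    then show ?thesis
      by (simp add: mult.commute)
  qed
  then have "norm (integral {a..b} (\<lambda>t. flow t (x t)))
      \<le> integral {a..b} (\<lambda>t. u_M * (\<alpha> + C * ((u t \<bullet> x t) * g (u t \<bullet> x t))))"
    using I D by (intro integral_norm_bound_integral) auto
  then show ?thesis
    unfolding integral_unique[OF I] integral_unique[OF D] .
qed

text \<open>Freezing the state at the start \<open>a\<close> of a window gives a fixed direction
  \<open>w\<close> for persistent excitation; passing from \<open>x a\<close> to \<open>x s\<close>
  costs only the drift bounded by \<open>flow_increment_le\<close>. \<open>T\<close> and
  \<open>\<kappa>\<close> are chosen before the solution, hence uniform in \<open>t0\<close>,
  \<open>J\<close>, \<open>x\<close> and \<open>a\<close>.\<close>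

lemma flow_energy_drop:
  assumes "\<eta> > 0"
  obtains T \<kappa> where "T > 0" "\<kappa> > 0"
    "\<And>t0 J x a. ode_solution flow t0 J x \<Longrightarrow> 0 \<le> t0 \<Longrightarrow> t0 \<le> a \<Longrightarrow> a + T \<in> J \<Longrightarrow> \<eta> \<le> norm (x a) \<Longrightarrow>
      (norm (x (a + T)))\<^sup>2 \<le> (norm (x a))\<^sup>2 - \<kappa>"
proof -
  obtain T \<epsilon> where T: "T > 0" and "\<epsilon> > 0"
    and "\<forall>t\<ge>0. \<forall>w. norm w = 1 \<longrightarrow> (1 / T) * integral {t..t + T} (\<lambda>s. \<bar>u s \<bullet> w\<bar>) \<ge> \<epsilon>"
    using u(1) unfolding persistently_exciting_def by blast
  then have PE: "\<epsilon> * T \<le> integral {t..t + T} (\<lambda>s. \<bar>u s \<bullet> w\<bar>)" if "t \<ge> 0" "norm w = 1" for t w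
    using that by (force simp: field_simps)
  \<comment> \<open>\<open>K\<close> is the common factor of \<open>T * \<alpha>\<close> and
    \<open>C * E\<close> once the drift bound \<open>B\<close> below is expanded in
    \<open>T * (\<alpha> + B) + C * E\<close>.\<close>
  define K where "K = 1 + T * u_M\<^sup>2"
  have "K > 0"
    using T by (simp add: K_def add_pos_nonneg)
  \<comment> \<open>This makes the term \<open>T * (\<alpha> * K)\<close> exactly half of the
    excitation bound \<open>\<eta> * (\<epsilon> * T)\<close>.\<close>
  define \<alpha> where "\<alpha> = \<epsilon> * \<eta> / (2 * K)"
  have "\<alpha> > 0"
    using \<open>\<epsilon> > 0\<close> \<open>\<eta> > 0\<close> \<open>K > 0\<close> by (simp add: \<alpha>_def)
  then obtain C where C: "C > 0" "\<And>y. \<bar>y\<bar> \<le> \<alpha> + C * (y * g y)" "\<And>y. \<bar>g y\<bar> \<le> \<alpha> + C * (y * g y)"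
    using abs_le_dissipation by blast
  \<comment> \<open>The other half of the excitation bound must be paid by \<open>K * C * E\<close>;
    solving for \<open>2 * E\<close>, the drop of the squared norm, gives
    \<open>\<kappa>\<close>.\<close>
  define \<kappa> where "\<kappa> = \<epsilon> * T * \<eta> / (K * C)"
  have "\<kappa> > 0"
    using \<open>\<epsilon> > 0\<close> \<open>\<eta> > 0\<close> \<open>K > 0\<close> T C(1) by (simp add: \<kappa>_def)
  moreover have "(norm (x (a + T)))\<^sup>2 \<le> (norm (x a))\<^sup>2 - \<kappa>"
    if sol: "ode_solution flow t0 J x" "0 \<le> t0" "t0 \<le> a" "a + T \<in> J" "\<eta> \<le> norm (x a)" for t0 J x a
  proof -
    define E where "E = ((norm (x a))\<^sup>2 - (norm (x (a + T)))\<^sup>2) / 2"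
    define w where "w = x a /\<^sub>R norm (x a)"
    have nz: "norm (x a) > 0"
      using sol(5) \<open>\<eta> > 0\<close> by linarith
    have w: "norm w = 1"
      using nz by (simp add: w_def)
    have xa: "\<bar>u s \<bullet> x a\<bar> = norm (x a) * \<bar>u s \<bullet> w\<bar>" for s
      using nz by (simp add: w_def abs_mult)
    have PE': "\<epsilon> * T \<le> integral {a..a + T} (\<lambda>s. \<bar>u s \<bullet> w\<bar>)"
      using PE w sol by simp
    \<comment> \<open>The integral of a non-integrable function is \<open>0\<close> by convention,
      so the positive lower bound forces integrability.\<close>
    then have "integral {a..a + T} (\<lambda>s. \<bar>u s \<bullet> w\<bar>) \<noteq> 0"
      using \<open>\<epsilon> > 0\<close> T by (smt (verit) mult_pos_pos)
    then have wi: "(\<lambda>s. \<bar>u s \<bullet> w\<bar>) integrable_on {a..a + T}"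
      using not_integrable_integral by blast
    define B where "B = u_M * (u_M * (\<alpha> * T + C * E))"
    have le: "\<bar>u s \<bullet> x a\<bar> \<le> (\<alpha> + B) + C * ((u s \<bullet> x s) * g (u s \<bullet> x s))" if s: "s \<in> {a..a + T}" for s
    proof -
      have sJ: "s \<in> J"
        using sol s unfolding ode_solution_def is_interval_1
        by (meson atLeastAtMost_iff order_trans)
      \<comment> \<open>Monotonicity of the norm bounds the energy lost up to \<open>s\<close> by
        the loss \<open>E\<close> over the whole window, so one drift bound serves every
        \<open>s\<close>.\<close>
      have "norm (x (a + T)) \<le> norm (x s)"
        using flow_norm_antimono[OF sol(1), of s "a + T"] sol s by simp
      then have E': "((norm (x a))\<^sup>2 - (norm (x s))\<^sup>2) / 2 \<le> E"
        by (simp add: E_def power_mono)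
      have "norm (x s - x a) \<le> u_M * (\<alpha> * (s - a) + C * (((norm (x a))\<^sup>2 - (norm (x s))\<^sup>2) / 2))"
        using flow_increment_le[OF sol(1-3) _ sJ C(3)] s by simp
      also have "\<dots> \<le> u_M * (\<alpha> * T + C * E)"
        using u_M_nonneg E' s \<open>\<alpha> > 0\<close> C(1)
        by (intro mult_left_mono add_mono) auto
      finally have inc: "norm (x s - x a) \<le> u_M * (\<alpha> * T + C * E)" .
      have "\<bar>u s \<bullet> (x s - x a)\<bar> \<le> norm (u s) * norm (x s - x a)"
        by (rule Cauchy_Schwarz_ineq2)
      also have "\<dots> \<le> B"
        unfolding B_def using inc u(2)[of s] u_M_nonneg sol s by (intro mult_mono) auto
      finally have "\<bar>u s \<bullet> x a\<bar> \<le> \<bar>u s \<bullet> x s\<bar> + B"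
        by (simp add: inner_diff_right)
      then show ?thesis
        using C(2)[of "u s \<bullet> x s"] by simp
    qed
    have "((\<lambda>s. (\<alpha> + B) + C * ((u s \<bullet> x s) * g (u s \<bullet> x s))) has_integral
        T * (\<alpha> + B) + C * E) {a..a + T}"
      unfolding E_def
      using has_integral_const_real[of "\<alpha> + B" a "a + T"] T sol
      by (intro has_integral_add has_integral_mult_right flow_energy[OF sol(1)]) auto
    moreover have "((\<lambda>s. \<bar>u s \<bullet> x a\<bar>) has_integral
        norm (x a) * integral {a..a + T} (\<lambda>s. \<bar>u s \<bullet> w\<bar>)) {a..a + T}"
      unfolding xa by (intro has_integral_mult_right integrable_integral wi)
    ultimately have "norm (x a) * integral {a..a + T} (\<lambda>s. \<bar>u s \<bullet> w\<bar>) \<le> T * (\<alpha> + B) + C * E"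
      using has_integral_le le by blast
    moreover have "\<eta> * (\<epsilon> * T) \<le> norm (x a) * integral {a..a + T} (\<lambda>s. \<bar>u s \<bullet> w\<bar>)"
      using sol(5) PE' \<open>\<eta> > 0\<close> \<open>\<epsilon> > 0\<close> T by (intro mult_mono) auto
    moreover have "T * (\<alpha> + B) + C * E = T * (\<alpha> * K) + K * C * E"
      by (simp add: B_def K_def algebra_simps power2_eq_square)
    moreover have "T * (\<alpha> * K) = \<eta> * (\<epsilon> * T) / 2"
      using \<open>K > 0\<close> by (simp add: \<alpha>_def)
    ultimately have "\<eta> * (\<epsilon> * T) / 2 \<le> K * C * E"
      by linarith
    then have "\<epsilon> * T * \<eta> / 2 \<le> K * C * E"
      by (simp add: algebra_simps)
    then have "\<kappa> \<le> 2 * E"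
      using \<open>K > 0\<close> C(1) by (simp add: \<kappa>_def field_simps)
    then show ?thesis
      by (simp add: E_def)
  qed
  ultimately show ?thesis
    using that T by blast
qed

section \<open>Uniform stability and uniform attractivity\<close>

text \<open>The norm never grows along a solution, so \<open>\<delta>\<close> can be the
  identity.\<close>

lemma flow_globally_uniformly_stable: "globally_uniformly_stable flow"
  unfolding globally_uniformly_stable_def
proof (intro exI[of _ "\<lambda>\<epsilon>. \<epsilon>"] conjI allI impI ballI; (elim conjE)?)
  show "filterlim (\<lambda>\<epsilon>::real. \<epsilon>) at_top at_top"
    by (rule filterlim_ident)
  fix \<epsilon> t0 t :: real and J x
  assume sol: "ode_solution flow t0 J x" "norm (x t0) < \<epsilon>" and "t \<in> J"
  then have "t0 \<le> t"
    by (auto simp: ode_solution_def)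
  then show "norm (x t) < \<epsilon>"
    using flow_norm_antimono[OF sol(1) order_refl] sol(2) \<open>t \<in> J\<close> by fastforce
qed

text \<open>A state of norm at least \<open>\<eta>\<close> after \<open>K\<close> windows would mean
  that every window cost at least \<open>\<kappa>\<close>, which exceeds the initial budget
  \<open>c\<^sup>2\<close>. The settling time \<open>K * T\<close> depends only on
  \<open>\<eta>\<close> and \<open>c\<close>.\<close>

lemma flow_globally_uniformly_attractive: "globally_uniformly_attractive flow"
  unfolding globally_uniformly_attractive_def
proof (intro allI impI)
  fix \<eta> c :: real assume "\<eta> > 0" "c > 0"
  obtain T \<kappa> where T: "T > 0" and "\<kappa> > 0" and drop:
    "\<And>t0 J x a. ode_solution flow t0 J x \<Longrightarrow> 0 \<le> t0 \<Longrightarrow> t0 \<le> a \<Longrightarrow> a + T \<in> J \<Longrightarrow> \<eta> \<le> norm (x a) \<Longrightarrow>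
      (norm (x (a + T)))\<^sup>2 \<le> (norm (x a))\<^sup>2 - \<kappa>"
    using flow_energy_drop[OF \<open>\<eta> > 0\<close>] by blast
  obtain K :: nat where K: "c\<^sup>2 < K * \<kappa>"
    using ex_less_of_nat_mult[OF \<open>\<kappa> > 0\<close>] by blast
  then have "K > 0"
    by (cases K) (auto simp: not_less)
  have small: "norm (x t) < \<eta>"
    if "t0 \<ge> 0" and sol: "ode_solution flow t0 J x" "norm (x t0) < c" and "t \<in> J" "t \<ge> t0 + K * T"
    for t0 J x t
  proof (rule ccontr)
    assume "\<not> norm (x t) < \<eta>"
    have J: "is_interval J" "t0 \<in> J"
      using sol by (auto simp: ode_solution_def)
    \<comment> \<open>Since the norm is nonincreasing, a late state outside the
      \<open>\<eta>\<close>-ball forces all earlier ones outside it, so \<open>drop\<close> applies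
      to each consecutive window.\<close>
    have big: "s \<in> J \<and> \<eta> \<le> norm (x s)" if "s \<in> {t0..t}" for s
    proof -
      have "norm (x t) \<le> norm (x s)"
        using flow_norm_antimono[OF sol(1)] that \<open>t \<in> J\<close> by auto
      moreover have "s \<in> J"
        using J that \<open>t \<in> J\<close> unfolding is_interval_1 by (meson atLeastAtMost_iff)
      ultimately show ?thesis
        using \<open>\<not> norm (x t) < \<eta>\<close> by simp
    qed
    have "(norm (x (t0 + k * T)))\<^sup>2 \<le> (norm (x t0))\<^sup>2 - k * \<kappa>" if "k \<le> K" for k :: nat
      using that
    proof (induction k)
      case (Suc k)
      have "Suc k * T \<le> K * T"
        using Suc.prems T by (intro mult_right_mono) auto
      then have k: "t0 + k * T \<in> {t0..t}" "t0 + k * T + T \<in> {t0..t}"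
        using T \<open>t \<ge> t0 + K * T\<close> by (auto simp: algebra_simps)
      have "(norm (x (t0 + k * T + T)))\<^sup>2 \<le> (norm (x (t0 + k * T)))\<^sup>2 - \<kappa>"
        using big[OF k(1)] big[OF k(2)] k(1) sol(1) \<open>t0 \<ge> 0\<close> by (intro drop[of t0 J]) auto
      then show ?case
        using Suc by (simp add: algebra_simps)
    qed simp
    from this[of K] have "K * \<kappa> \<le> (norm (x t0))\<^sup>2"
      using zero_le_power2[of "norm (x (t0 + K * T))"] by linarith
    also have "\<dots> \<le> c\<^sup>2"
      using sol(2) by (intro power_mono) auto
    finally show False
      using K by simp
  qed
  show "\<exists>\<tau>>0. \<forall>t0\<ge>0. \<forall>J x. ode_solution flow t0 J x \<and> norm (x t0) < c \<longrightarrow>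
      (\<forall>t\<in>J. t \<ge> t0 + \<tau> \<longrightarrow> norm (x t) < \<eta>)"
    using small T \<open>K > 0\<close> by (intro exI[of _ "K * T"]) auto
qed

lemma flow_origin_GUAS: "origin_GUAS flow"
  using flow_globally_uniformly_stable flow_globally_uniformly_attractive
  by (simp add: origin_GUAS_def g_0)

end

section \<open>Sums of signed powers\<close>

text \<open>For positive \<open>p\<close>, \<open>\<bar>y\<bar> powr p\<close> tends to
  \<open>0\<close> at \<open>0\<close>, and it dominates the absolute value of the signed
  power.\<close>

lemma isCont_signed_power_0:
  assumes "p > 0"
  shows "isCont (\<lambda>y. signed_power y p) 0"
proof -
  have "((\<lambda>y::real. \<bar>y\<bar> powr p) \<longlongrightarrow> \<bar>0\<bar> powr p) (at 0)"
    using assms by (intro tendsto_powr' tendsto_intros) auto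
  then have "((\<lambda>y. signed_power y p) \<longlongrightarrow> 0) (at 0)"
    by (rule_tac tendsto_rabs_zero_cancel, rule_tac tendsto_0_le[where K = 1])
       (use assms in \<open>auto simp: signed_power_def abs_mult sgn_real_def\<close>)
  then show ?thesis
    by (simp add: isCont_def signed_power_def)
qed

lemma mult_signed_power_nonneg: "0 \<le> y * signed_power y p"
  by (simp add: signed_power_def sgn_real_def zero_le_mult_iff)

lemma mult_signed_power: "y * signed_power y p = \<bar>y\<bar> * \<bar>y\<bar> powr p"
  by (simp add: signed_power_def sgn_real_def)

theorem theorem5:
  fixes u :: "real \<Rightarrow> real ^ 'n" and u_M :: real
    and h :: nat and p :: "nat \<Rightarrow> real" and p_m p_M :: real
  assumes "piecewise_continuous u"
    and "persistently_exciting u"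
    and "\<forall>t\<ge>0. norm (u t) \<le> u_M"
    and "h \<ge> 1"
    and "\<forall>i\<in>{1..h}. p i > 0"
    and "p_m = Min (p ` {1..h})"
    and "p_M = Max (p ` {1..h})"
    and "p_M \<le> p_m + 1"
  shows "origin_GUAS (\<lambda>t x. - ((\<Sum>i=1..h. signed_power (u t \<bullet> x) (p i)) *\<^sub>R u t))"
proof (rule flow_origin_GUAS[where u_M = u_M and g = "\<lambda>y. \<Sum>i=1..h. signed_power y (p i)"])
  show "persistently_exciting u" by fact
  show "norm (u t) \<le> u_M" if "t \<ge> 0" for t
    using assms(3) that by blast
  show "(\<Sum>i=1..h. signed_power 0 (p i)) = 0"
    by (simp add: signed_power_def)
  show "isCont (\<lambda>y. \<Sum>i=1..h. signed_power y (p i)) 0"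
    using assms(5) by (intro continuous_sum isCont_signed_power_0) auto
  show "0 \<le> y * (\<Sum>i=1..h. signed_power y (p i))" for y
    by (simp add: sum_distrib_left sum_nonneg mult_signed_power_nonneg)
  show "\<exists>m>0. \<forall>y. \<delta> \<le> \<bar>y\<bar> \<longrightarrow> m \<le> \<bar>\<Sum>i=1..h. signed_power y (p i)\<bar>" if "\<delta> > 0" for \<delta>
  \<comment> \<open>All signed powers of \<open>y\<close> share the sign of \<open>y\<close>, so
    nothing cancels and a single summand bounds the sum from below. Index \<open>1\<close> is
    available because \<open>h \<ge> 1\<close>; multiplying by \<open>y\<close> makes every summand
    nonnegative.\<close>
  proof (intro exI[of _ "\<delta> powr p 1"] conjI allI impI)
    fix y assume y: "\<delta> \<le> \<bar>y\<bar>"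
    have 1: "1 \<in> {1..h}"
      using assms(4) by simp
    have "\<bar>y\<bar> * \<delta> powr p 1 \<le> y * signed_power y (p 1)"
      unfolding mult_signed_power
      using y that assms(5) 1 by (intro mult_left_mono powr_mono2) (auto intro: less_imp_le)
    also have "\<dots> \<le> (\<Sum>i=1..h. y * signed_power y (p i))"
      by (rule member_le_sum[OF 1]) (simp_all add: mult_signed_power_nonneg)
    also have "\<dots> \<le> \<bar>y\<bar> * \<bar>\<Sum>i=1..h. signed_power y (p i)\<bar>"
      by (simp add: sum_distrib_left[symmetric] abs_mult[symmetric])
    finally show "\<delta> powr p 1 \<le> \<bar>\<Sum>i=1..h. signed_power y (p i)\<bar>"
      using y that by (simp add: mult_le_cancel_left)
  qed (use that in simp)
qed

end
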